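(* Let $A$ be a finite set with $|A|=r$. Let $H$ be a finite graph in which each vertex $v$ carries a support $\sigma(v)\subseteq A$, such that distinct vertices $u,v$ are adjacent iff $\sigma(u)\cap\sigma(v)=\emptyset$, and such that for every $a\in A$ some vertex has support exactly $\{a\}$. Let $c\ge1$, $k_1,\ldots,k_c\ge 2$, and $M=\sum_{i=1}^c(k_i-1)$. Say that $H$ is forcing if every coloring of $V(H)$ with colors $1,\ldots,c$ has some color $i$ whose color class contains a clique of $H$ with $k_i$ vertices. (a) If exactly one vertex of $H$ has empty support, then $H$ is forcing if and only if $r\ge M$. (b) If every vertex of $H$ has nonempty support, then $H$ is forcing if and only if $r\ge M+1$.
   Context: In case (b), vertices with support equal to all of $A$ are allowed. *)

theory Defs
  imports "HOL-Library.Ramsey" "HOL-Library.FuncSet"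
begin

definition simple_graph :: "'v set \<Rightarrow> 'v set set \<Rightarrow> bool" where
  "simple_graph V E \<longleftrightarrow> E \<subseteq> [V]\<^bsup>2\<^esup>"

definition forcing :: "'v set \<Rightarrow> 'v set set \<Rightarrow> nat \<Rightarrow> (nat \<Rightarrow> nat) \<Rightarrow> bool" where
  "forcing V E c k \<longleftrightarrow>
     (\<forall>\<chi> \<in> V \<rightarrow> {1..c}. \<exists>i\<in>{1..c}. \<exists>K \<subseteq> {v \<in> V. \<chi> v = i}. card K = k i \<and> clique K E)"

end

theory Submission
  imports Defs
begin

text \<open>
  Let \<open>Z\<close> be the set of vertices with empty support. Choosing an element of each nonempty support
  and keeping each vertex of \<open>Z\<close> as its own colour properly colours \<open>H\<close> by the disjoint sum of
  \<open>A\<close> and \<open>Z\<close>, while one vertex of support \<open>{a}\<close> for each \<open>a\<close> together with \<open>Z\<close> is a clique of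
  the same size \<open>r + |Z|\<close>. A graph whose chromatic and clique numbers both equal \<open>n\<close> is
  forcing iff \<open>n > M\<close>: if \<open>n > M\<close>, apply the pigeonhole principle to the clique; if \<open>n \<le> M\<close>,
  merge the \<open>n\<close> proper colours into \<open>c\<close> groups of sizes at most \<open>k\<^sub>i - 1\<close>.
\<close>

text \<open>The bound on \<open>card X\<close> lets \<open>X\<close> be injected into a disjoint
  union of blocks, where block \<open>i\<close> has \<open>n i\<close> elements. Reading off the
  block index gives \<open>f\<close>, and each fibre injects into a single block.\<close>

lemma ex_map_bounded_fibers:
  fixes n :: "'i \<Rightarrow> nat"
  assumes "finite X" "finite I" and le: "card X \<le> (\<Sum>i\<in>I. n i)"
  obtains f where "f \<in> X \<rightarrow> I" and "\<And>i. i \<in> I \<Longrightarrow> card {x \<in> X. f x = i} \<le> n i"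
proof -
  have "card X \<le> card (Sigma I (\<lambda>i. {..<n i}))"
    using assms by (simp add: card_SigmaI)
  then obtain g where g: "g ` X \<subseteq> Sigma I (\<lambda>i. {..<n i})" "inj_on g X"
    using assms card_le_inj[of X "Sigma I (\<lambda>i. {..<n i})"] by auto
  show thesis
  proof
    show "fst \<circ> g \<in> X \<rightarrow> I"
      using g(1) by force
    fix i assume "i \<in> I"
    have "card {x \<in> X. (fst \<circ> g) x = i} \<le> card ({i} \<times> {..<n i})"
    proof (rule card_inj_on_le)
      show "inj_on g {x \<in> X. (fst \<circ> g) x = i}"
        using g(2) by (rule inj_on_subset) auto
      show "g ` {x \<in> X. (fst \<circ> g) x = i} \<subseteq> {i} \<times> {..<n i}"
        using g(1) by fastforce
    qed simp
    then show "card {x \<in> X. (fst \<circ> g) x = i} \<le> n i"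
      by (simp add: card_cartesian_product)
  qed
qed

lemma forcing_if_large_clique:
  assumes "finite Q" "Q \<subseteq> V" "clique Q E" and gt: "(\<Sum>i=1..c. k i - 1) < card Q"
  shows "forcing V E c k"
  unfolding forcing_def
proof
  fix \<chi> assume \<chi>: "\<chi> \<in> V \<rightarrow> {1..c}"
  have "card Q = (\<Sum>i=1..c. card {q \<in> Q. \<chi> q = i})"
    \<comment> \<open>Summing the constant 1 over the colour classes counts \<open>Q\<close> class
      by class.\<close>
    using sum.group[of Q "{1..c}" \<chi> "\<lambda>_. 1::nat"] \<chi> assms(1,2) by fastforce
  then have "\<not> (\<forall>i\<in>{1..c}. card {q \<in> Q. \<chi> q = i} \<le> k i - 1)"
    using gt sum_mono[of "{1..c}" "\<lambda>i. card {q \<in> Q. \<chi> q = i}" "\<lambda>i. k i - 1"] by fastforce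
  then obtain i where i: "i \<in> {1..c}" "k i \<le> card {q \<in> Q. \<chi> q = i}"
    by fastforce
  then obtain K where K: "K \<subseteq> {q \<in> Q. \<chi> q = i}" "card K = k i"
    by (meson obtain_subset_with_card_n)
  then have "K \<subseteq> {v \<in> V. \<chi> v = i}" "clique K E"
    using assms(2,3) unfolding clique_def by blast+
  with i K show "\<exists>i\<in>{1..c}. \<exists>K\<subseteq>{v \<in> V. \<chi> v = i}. card K = k i \<and> clique K E"
    by blast
qed

text \<open>Merging the proper colours by a map \<open>f\<close> with fibres of size at most
  \<open>k i - 1\<close> gives a bad colouring \<open>f \<circ> p\<close>: on a clique
  \<open>p\<close> is injective, so a clique of colour \<open>i\<close> is no larger than the fibre
  of \<open>f\<close> over \<open>i\<close>.\<close>

lemma not_forcing_if_proper_coloring: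
  assumes "finite X" and p: "p \<in> V \<rightarrow> X"
    and proper: "\<And>u v. u \<in> V \<Longrightarrow> v \<in> V \<Longrightarrow> u \<noteq> v \<Longrightarrow> {u, v} \<in> E \<Longrightarrow> p u \<noteq> p v"
    and k: "\<And>i. i \<in> {1..c} \<Longrightarrow> k i \<ge> 1"
    and le: "card X \<le> (\<Sum>i=1..c. k i - 1)"
  shows "\<not> forcing V E c k"
proof
  assume forcing: "forcing V E c k"
  obtain f where f: "f \<in> X \<rightarrow> {1..c}"
    and fib: "\<And>i. i \<in> {1..c} \<Longrightarrow> card {x \<in> X. f x = i} \<le> k i - 1"
    using ex_map_bounded_fibers[OF \<open>finite X\<close> _ le] by auto
  have "f \<circ> p \<in> V \<rightarrow> {1..c}"
    using f p by auto
  then obtain i K where i: "i \<in> {1..c}" and K: "K \<subseteq> {v \<in> V. (f \<circ> p) v = i}"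
    and card: "card K = k i" and cl: "clique K E"
    using forcing unfolding forcing_def by blast
  have "card K \<le> card {x \<in> X. f x = i}"
  proof (rule card_inj_on_le)
    show "inj_on p K"
    proof (rule inj_onI, rule ccontr)
      fix u v assume uv: "u \<in> K" "v \<in> K" "p u = p v" "u \<noteq> v"
      then have "{u, v} \<in> E"
        using cl by (simp add: clique_def)
      with uv K proper[of u v] show False
        by auto
    qed
    show "p ` K \<subseteq> {x \<in> X. f x = i}"
      using K p by auto
  qed (use \<open>finite X\<close> in simp)
  \<comment> \<open>Here \<open>k i \<ge> 1\<close> matters: subtraction on naturals truncates, so
    \<open>k i \<le> k i - 1\<close> is absurd only for positive \<open>k i\<close>.\<close>
  with fib[OF i] k[OF i] card show False
    by linarith
qed

text \<open>Leaving the number of vertices with empty support arbitrary treats both cases at once: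
  they are the values 1 and 0 of this number.\<close>

lemma forcing_disjointness_graph_iff:
  fixes A :: "'a set" and V :: "'v set" and \<sigma> :: "'v \<Rightarrow> 'a set"
  assumes "finite A" "finite V"
    and sub: "\<And>v. v \<in> V \<Longrightarrow> \<sigma> v \<subseteq> A"
    and adj: "\<And>u v. u \<in> V \<Longrightarrow> v \<in> V \<Longrightarrow> u \<noteq> v \<Longrightarrow> {u, v} \<in> E \<longleftrightarrow> \<sigma> u \<inter> \<sigma> v = {}"
    and single: "\<And>a. a \<in> A \<Longrightarrow> \<exists>v\<in>V. \<sigma> v = {a}"
    and k: "\<And>i. i \<in> {1..c} \<Longrightarrow> k i \<ge> 1"
  shows "forcing V E c k \<longleftrightarrow> (\<Sum>i=1..c. k i - 1) < card A + card {v \<in> V. \<sigma> v = {}}"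
proof -
  define Z where "Z = {v \<in> V. \<sigma> v = {}}"
  have "finite Z"
    using \<open>finite V\<close> by (simp add: Z_def)
  show ?thesis
    unfolding Z_def[symmetric]
  proof
    assume forcing: "forcing V E c k"
    define p :: "'v \<Rightarrow> 'a + 'v"
      where "p v = (if \<sigma> v = {} then Inr v else Inl (SOME a. a \<in> \<sigma> v))" for v
    have some: "(SOME a. a \<in> \<sigma> v) \<in> \<sigma> v" if "\<sigma> v \<noteq> {}" for v
      using that by (simp add: some_in_eq)
    have p: "p \<in> V \<rightarrow> A <+> Z"
      using some sub by (fastforce simp: p_def Z_def)
    \<comment> \<open>Equal \<open>Inl\<close> colours would put a common element into two disjoint
      supports; \<open>Inr\<close> colours are the vertices themselves.\<close>
    have proper: "p u \<noteq> p v" if "u \<in> V" "v \<in> V" "u \<noteq> v" "{u, v} \<in> E" for u v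
      using adj[OF that(1-3)] that some[of u] some[of v]
      by (cases "\<sigma> u = {}"; cases "\<sigma> v = {}") (simp_all add: p_def disjoint_iff, metis)
    have "\<not> card (A <+> Z) \<le> (\<Sum>i=1..c. k i - 1)"
    proof
      assume "card (A <+> Z) \<le> (\<Sum>i=1..c. k i - 1)"
      with p proper k have "\<not> forcing V E c k"
        by (intro not_forcing_if_proper_coloring[of "A <+> Z" p])
          (use \<open>finite A\<close> \<open>finite Z\<close> in auto)
      with forcing show False by contradiction
    qed
    then show "(\<Sum>i=1..c. k i - 1) < card A + card Z"
      using \<open>finite A\<close> \<open>finite Z\<close> by (simp add: card_Plus)
  next
    assume gt: "(\<Sum>i=1..c. k i - 1) < card A + card Z"
    obtain s where s: "\<And>a. a \<in> A \<Longrightarrow> s a \<in> V \<and> \<sigma> (s a) = {a}"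
      using single by metis
    have "inj_on s A"
      using s by (metis inj_onI singleton_inject)
    moreover have "s ` A \<inter> Z = {}"
      using s by (auto simp: Z_def)
    ultimately have card: "card (s ` A \<union> Z) = card A + card Z"
      using \<open>finite A\<close> \<open>finite Z\<close> by (simp add: card_Un_disjoint card_image)
    have V: "s ` A \<union> Z \<subseteq> V"
      using s by (auto simp: Z_def)
    \<comment> \<open>Distinct values of \<open>s\<close> come from distinct elements of
      \<open>A\<close>, so their singleton supports are disjoint; an empty support is disjoint from
      every support.\<close>
    have disj: "\<sigma> u \<inter> \<sigma> v = {}" if "u \<in> s ` A \<union> Z" "v \<in> s ` A \<union> Z" "u \<noteq> v" for u v
      using that s by (auto simp: Z_def)
    have "clique (s ` A \<union> Z) E"
      unfolding clique_def using V disj adj by (meson subsetD)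
    then show "forcing V E c k"
      using forcing_if_large_clique[OF _ V] card gt \<open>finite A\<close> \<open>finite Z\<close> by simp
  qed
qed

theorem theorem4p1:
  fixes A :: "'a set" and V :: "'v set" and E :: "'v set set"
    and \<sigma> :: "'v \<Rightarrow> 'a set" and r c M :: nat and k :: "nat \<Rightarrow> nat"
  assumes "finite A" and "card A = r"
    and "finite V" and "simple_graph V E"
    and "\<And>v. v \<in> V \<Longrightarrow> \<sigma> v \<subseteq> A"
    and "\<And>u v. u \<in> V \<Longrightarrow> v \<in> V \<Longrightarrow> u \<noteq> v \<Longrightarrow> {u, v} \<in> E \<longleftrightarrow> \<sigma> u \<inter> \<sigma> v = {}"
    and "\<And>a. a \<in> A \<Longrightarrow> \<exists>v\<in>V. \<sigma> v = {a}"
    and "c \<ge> 1" and "\<And>i. i \<in> {1..c} \<Longrightarrow> k i \<ge> 2"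
    and "M = (\<Sum>i=1..c. k i - 1)"
  shows "((\<exists>!v. v \<in> V \<and> \<sigma> v = {}) \<longrightarrow> (forcing V E c k \<longleftrightarrow> r \<ge> M))
       \<and> ((\<forall>v\<in>V. \<sigma> v \<noteq> {}) \<longrightarrow> (forcing V E c k \<longleftrightarrow> r \<ge> M + 1))"
proof -
  have "k i \<ge> 1" if "i \<in> {1..c}" for i
    using assms(9)[OF that] by simp
  then have iff: "forcing V E c k \<longleftrightarrow> M < r + card {v \<in> V. \<sigma> v = {}}"
    unfolding assms(10) assms(2)[symmetric]
    by (intro forcing_disjointness_graph_iff assms(1,3,5-7))
  show ?thesis
  proof (intro conjI impI)
    assume "\<exists>!v. v \<in> V \<and> \<sigma> v = {}"
    then obtain z where "{v \<in> V. \<sigma> v = {}} = {z}"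
      by auto
    then show "forcing V E c k \<longleftrightarrow> r \<ge> M"
      using iff by auto
  next
    assume "\<forall>v\<in>V. \<sigma> v \<noteq> {}"
    then have "{v \<in> V. \<sigma> v = {}} = {}"
      by blast
    then have "card {v \<in> V. \<sigma> v = {}} = 0"
      by (simp only: card.empty)
    then show "forcing V E c k \<longleftrightarrow> r \<ge> M + 1"
      using iff by linarith
  qed
qed

end
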